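(* For all $4$-tuples of non-negative integers $M=(m_1,m_2,m_1',m_2')$ and $N=(n_1,n_2,n_1',n_2')$, $$\int_{\mathbb{C}^2} H_{m_1,m_2,m_1',m_2'}(z,w)\,\overline{H_{n_1,n_2,n_1',n_2'}(z,w)}\; e^{-2(|z|^2+|w|^2)}\,d\lambda(z,w)=\frac{\pi^2}{4}\,M!\,\delta_{M,N}.$$
   Context: For integers $m,n\ge 0$ and $\zeta\in\mathbb{C}$, the univariate complex Hermite polynomials are $H_{m,n}(\zeta,\overline{\zeta})=(-1)^{m+n}e^{|\zeta|^2}\frac{\partial^{m+n}}{\partial\overline{\zeta}^{m}\partial\zeta^{n}}\left(e^{-|\zeta|^2}\right)$ (Wirtinger derivatives). For $m,n,m',n'\ge 0$ and $(z,w)\in\mathbb{C}^2$, the bivariate complex Hermite polynomials are $H_{m,n,m',n'}(z,w)=H_{m,n}(z+iw,\overline{z}-i\overline{w})\,H_{m',n'}(\overline{z}+i\overline{w},z-iw)$. (Note $\overline{z}-i\overline{w}$ is the complex conjugate of $z+iw$ and $z-iw$ is the complex conjugate of $\overline{z}+i\overline{w}$.) Here $d\lambda$ is Lebesgue measure on $\mathbb{C}^2=\mathbb{R}^4$, $M!=m_1!\,m_2!\,m_1'!\,m_2'!$, and $\delta_{M,N}=\delta_{m_1,n_1}\delta_{m_2,n_2}\delta_{m_1',n_1'}\delta_{m_2',n_2'}$. *)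

theory Defs
  imports "HOL-Analysis.Analysis"
begin

text \<open>Wirtinger derivatives \<open>\<partial>/\<partial>\<zeta> = (\<partial>/\<partial>x - \<i> \<partial>/\<partial>y)/2\<close> and
  \<open>\<partial>/\<partial>\<zeta>bar = (\<partial>/\<partial>x + \<i> \<partial>/\<partial>y)/2\<close> for \<open>\<zeta> = x + \<i> y\<close>.\<close>

definition partial_x :: "(complex \<Rightarrow> complex) \<Rightarrow> complex \<Rightarrow> complex" where
  "partial_x f \<zeta> = vector_derivative (\<lambda>t::real. f (\<zeta> + of_real t)) (at 0)"

definition partial_y :: "(complex \<Rightarrow> complex) \<Rightarrow> complex \<Rightarrow> complex" where
  "partial_y f \<zeta> = vector_derivative (\<lambda>t::real. f (\<zeta> + \<i> * of_real t)) (at 0)"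

definition wirtinger :: "(complex \<Rightarrow> complex) \<Rightarrow> complex \<Rightarrow> complex" where
  "wirtinger f \<zeta> = (partial_x f \<zeta> - \<i> * partial_y f \<zeta>) / 2"

definition wirtinger_cnj :: "(complex \<Rightarrow> complex) \<Rightarrow> complex \<Rightarrow> complex" where
  "wirtinger_cnj f \<zeta> = (partial_x f \<zeta> + \<i> * partial_y f \<zeta>) / 2"

text \<open>The second argument of \<open>H\<^sub>m\<^sub>,\<^sub>n(\<zeta>, \<zeta>bar)\<close> is always the conjugate of the first,
  so only \<open>\<zeta>\<close> is kept.\<close>

definition hermite_uni :: "nat \<Rightarrow> nat \<Rightarrow> complex \<Rightarrow> complex" where
  "hermite_uni m n \<zeta> =
     (-1) ^ (m + n) * of_real (exp ((cmod \<zeta>)\<^sup>2)) *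
     (wirtinger_cnj ^^ m) ((wirtinger ^^ n) (\<lambda>\<xi>. of_real (exp (- ((cmod \<xi>)\<^sup>2))))) \<zeta>"

text \<open>The omitted second arguments are \<open>cnj z - \<i> * cnj w\<close> and \<open>z - \<i> * w\<close>.\<close>

definition hermite_biv ::
    "nat \<Rightarrow> nat \<Rightarrow> nat \<Rightarrow> nat \<Rightarrow> complex \<Rightarrow> complex \<Rightarrow> complex" where
  "hermite_biv m n m' n' z w =
     hermite_uni m n (z + \<i> * w) * hermite_uni m' n' (cnj z + \<i> * cnj w)"

end

theory Submission
  imports Defs "HOL-Probability.Distributions"
begin

text \<open>
  The substitution \<open>u = z + \<i>w\<close>, \<open>v = zbar + \<i>wbar\<close> satisfies
  \<open>|u|\<^sup>2 + |v|\<^sup>2 = 2(|z|\<^sup>2 + |w|\<^sup>2)\<close> and has real Jacobian 4, so the integral is a quarter of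
  a product of two univariate ones. Since
  \<open>H\<^sub>m\<^sub>+\<^sub>1\<^sub>,\<^sub>n e\<close> is \<open>-\<partial>/\<partial>\<zeta>bar\<close> of \<open>H\<^sub>m\<^sub>,\<^sub>n e\<close> for the Gaussian \<open>e = exp(-|\<zeta>|\<^sup>2)\<close>, and
  \<open>\<partial>/\<partial>\<zeta>\<close> maps \<open>H\<^sub>p\<^sub>,\<^sub>q\<close> to \<open>p H\<^sub>p\<^sub>-\<^sub>1\<^sub>,\<^sub>q\<close>, integration by parts gives
  \<open>\<langle>H\<^sub>m\<^sub>+\<^sub>1\<^sub>,\<^sub>n, H\<^sub>p\<^sub>,\<^sub>q\<rangle> = p \<langle>H\<^sub>m\<^sub>,\<^sub>n, H\<^sub>p\<^sub>-\<^sub>1\<^sub>,\<^sub>q\<rangle>\<close>, and similarly in the second index;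
  this recursion ends at \<open>\<langle>1, 1\<rangle> = \<pi>\<close>.
\<close>

subsection \<open>Measure-preserving maps and the change of variables\<close>

text \<open>Boxes determine Lebesgue measure, so only the areas of their preimages matter. For the
  three maps treated below these preimages are axis-parallel rectangles.\<close>

lemma lborel_complex_eqI:
  fixes f :: "'a::euclidean_space \<Rightarrow> complex"
  assumes [measurable]: "f \<in> borel_measurable borel"
    and "\<And>l u. Re l \<le> Re u \<Longrightarrow> Im l \<le> Im u \<Longrightarrow>
      emeasure lborel (f -` box l u) = ennreal ((Re u - Re l) * (Im u - Im l))"
  shows "distr lborel borel f = lborel"
proof (rule lborel_eqI[symmetric])
  fix l u :: complex
  assume "\<And>b. b \<in> Basis \<Longrightarrow> l \<bullet> b \<le> u \<bullet> b"
  from this[of 1] this[of \<i>] have "Re l \<le> Re u" "Im l \<le> Im u"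
    by simp_all
  with assms(2)[of l u]
  show "emeasure (distr lborel borel f) (box l u) = ennreal (\<Prod>b\<in>Basis. (u - l) \<bullet> b)"
    by (simp add: emeasure_distr Basis_complex_def)
qed simp

lemma emeasure_lborel_complex_box:
  assumes "Re l \<le> Re u" "Im l \<le> Im u"
  shows "emeasure lborel (box l u) = ennreal ((Re u - Re l) * (Im u - Im l))"
  using assms by (subst emeasure_lborel_box) (auto simp: Basis_complex_def)

lemma lborel_distr_Complex:
  "distr (lborel :: (real \<times> real) measure) borel (\<lambda>(x, y). Complex x y) = lborel"
proof (rule lborel_complex_eqI)
  show "(\<lambda>(x, y). Complex x y) \<in> borel_measurable borel"
    unfolding case_prod_unfold Complex_eq by (intro borel_measurable_continuous_onI continuous_intros)
next
  fix l u assume "Re l \<le> Re u" "Im l \<le> Im u"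
  moreover have "(\<lambda>(x, y). Complex x y) -` box l u = box (Re l) (Re u) \<times> box (Im l) (Im u)"
    by (auto simp: in_box_complex_iff)
  ultimately show "emeasure lborel ((\<lambda>(x, y). Complex x y) -` box l u) =
      ennreal ((Re u - Re l) * (Im u - Im l))"
    by (simp add: lborel_prod[symmetric] lborel.emeasure_pair_measure_Times ennreal_mult)
qed

lemma lborel_distr_cnj: "distr lborel borel cnj = lborel"
proof (rule lborel_complex_eqI)
  fix l u assume "Re l \<le> Re u" "Im l \<le> Im u"
  moreover have "cnj -` box l u = box (Complex (Re l) (- Im u)) (Complex (Re u) (- Im l))"
    by (auto simp: in_box_complex_iff)
  ultimately show "emeasure lborel (cnj -` box l u) = ennreal ((Re u - Re l) * (Im u - Im l))"
    by (simp add: emeasure_lborel_complex_box)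
qed (intro borel_measurable_continuous_onI continuous_intros)

lemma lborel_distr_mult_ii: "distr lborel borel ((*) \<i>) = lborel"
proof (rule lborel_complex_eqI)
  fix l u assume "Re l \<le> Re u" "Im l \<le> Im u"
  moreover have "(*) \<i> -` box l u = box (Complex (Im l) (- Re u)) (Complex (Im u) (- Re l))"
    by (auto simp: in_box_complex_iff)
  ultimately show "emeasure lborel ((*) \<i> -` box l u) = ennreal ((Re u - Re l) * (Im u - Im l))"
    by (simp add: emeasure_lborel_complex_box mult.commute)
qed (intro borel_measurable_continuous_onI continuous_intros)

text \<open>Tonelli takes the place of a Jacobian. Over \<open>x\<close> in \<open>A\<close> the
  section of the preimage of \<open>A \<times> B\<close> is the preimage of \<open>B\<close> under
  \<open>\<phi> x\<close>, whose measure is \<open>emeasure K B\<close> by \<open>slice\<close>;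
  over other \<open>x\<close> it is empty.\<close>

lemma distr_pair_shear:
  assumes N: "sigma_finite_measure N" and M: "sigma_finite_measure M" and K: "sigma_finite_measure K"
    and meas [measurable]: "case_prod \<phi> \<in> M \<Otimes>\<^sub>M N \<rightarrow>\<^sub>M K"
    and slice: "\<And>x. x \<in> space M \<Longrightarrow> distr N K (\<phi> x) = K"
  shows "distr (M \<Otimes>\<^sub>M N) (M \<Otimes>\<^sub>M K) (\<lambda>(x, y). (x, \<phi> x y)) = M \<Otimes>\<^sub>M K"
proof (rule pair_measure_eqI[OF M K, symmetric])
  interpret N: sigma_finite_measure N by fact
  fix A B assume A [measurable]: "A \<in> sets M" and B [measurable]: "B \<in> sets K"
  let ?S = "(\<lambda>(x, y). (x, \<phi> x y)) -` (A \<times> B) \<inter> space (M \<Otimes>\<^sub>M N)"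
  have mS: "(\<lambda>(x, y). (x, \<phi> x y)) \<in> M \<Otimes>\<^sub>M N \<rightarrow>\<^sub>M M \<Otimes>\<^sub>M K"
    by measurable
  have "?S \<in> sets (M \<Otimes>\<^sub>M N)"
    by (rule measurable_sets[OF mS]) simp
  then have "emeasure (M \<Otimes>\<^sub>M N) ?S = (\<integral>\<^sup>+x. emeasure N (Pair x -` ?S) \<partial>M)"
    by (rule N.emeasure_pair_measure_alt)
  also have "\<dots> = (\<integral>\<^sup>+x. emeasure K B * indicator A x \<partial>M)"
  proof (rule nn_integral_cong)
    fix x assume x: "x \<in> space M"
    then have [measurable]: "\<phi> x \<in> N \<rightarrow>\<^sub>M K"
      using measurable_Pair2[OF meas, of x] by simp
    have "emeasure K B = emeasure N (\<phi> x -` B \<inter> space N)"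
      by (subst slice[OF x, symmetric]) (simp add: emeasure_distr)
    moreover have "Pair x -` ?S = (if x \<in> A then \<phi> x -` B \<inter> space N else {})"
      using x by (auto simp: space_pair_measure)
    ultimately show "emeasure N (Pair x -` ?S) = emeasure K B * indicator A x"
      by simp
  qed
  also have "\<dots> = emeasure M A * emeasure K B"
    using nn_integral_cmult_indicator[OF A, of "emeasure K B"] by (simp only: mult.commute)
  finally show "emeasure M A * emeasure K B =
      emeasure (distr (M \<Otimes>\<^sub>M N) (M \<Otimes>\<^sub>M K) (\<lambda>(x, y). (x, \<phi> x y))) (A \<times> B)"
    by (simp add: emeasure_distr mS)
qed simp

lemma has_bochner_integral_mp:
  fixes f :: "'b \<Rightarrow> 'c::{banach, second_countable_topology}"
  assumes "has_bochner_integral N f I" and "distr M N T = N" and "T \<in> M \<rightarrow>\<^sub>M N"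
  shows "has_bochner_integral M (\<lambda>x. f (T x)) I"
proof -
  have f: "f \<in> borel_measurable N"
    using assms(1) by (rule borel_measurable_has_bochner_integral)
  show ?thesis
    using assms(1) integrable_distr_eq[OF assms(3) f] integral_distr[OF assms(3) f] assms(2)
    by (simp add: has_bochner_integral_iff)
qed

lemma has_bochner_integral_pair_mult:
  fixes f :: "'a \<Rightarrow> 'c::{real_normed_field, banach, second_countable_topology}"
  assumes "sigma_finite_measure M" "sigma_finite_measure N"
    and f: "has_bochner_integral M f I" and g: "has_bochner_integral N g J"
  shows "has_bochner_integral (M \<Otimes>\<^sub>M N) (\<lambda>(x, y). f x * g y) (I * J)"
proof -
  interpret pair_sigma_finite M N
    using assms by (simp add: pair_sigma_finite_def)
  have [measurable]: "f \<in> borel_measurable M" "g \<in> borel_measurable N"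
    using f g by (auto intro: borel_measurable_has_bochner_integral)
  have fg: "integrable M f" "integrable N g"
    using f g by (auto simp: has_bochner_integral_iff)
  have int: "integrable (M \<Otimes>\<^sub>M N) (\<lambda>(x, y). f x * g y)"
  proof (rule Fubini_integrable)
    show "integrable M (\<lambda>x. \<integral>y. norm (case (x, y) of (x, y) \<Rightarrow> f x * g y) \<partial>N)"
      using fg by (simp add: norm_mult integrable_mult_left integrable_norm)
    show "AE x in M. integrable N (\<lambda>y. case (x, y) of (x, y) \<Rightarrow> f x * g y)"
      using fg by simp
  qed simp
  have "(\<integral>z. (case z of (x, y) \<Rightarrow> f x * g y) \<partial>(M \<Otimes>\<^sub>M N)) = (\<integral>x. (\<integral>y. f x * g y \<partial>N) \<partial>M)"
    using integral_fst'[OF int] by simp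
  also have "\<dots> = I * J"
    using f g by (simp add: has_bochner_integral_iff)
  finally show ?thesis
    using int by (simp add: has_bochner_integral_iff)
qed

text \<open>\<open>lborel_affine\<close> writes Lebesgue measure as its image under scaling with a
  constant density; dividing by that density gives the factor, which is 1/4 on the plane for
  \<open>c = 2\<close>.\<close>

lemma has_bochner_integral_lborel_scaleR:
  fixes g :: "'a::euclidean_space \<Rightarrow> 'b::{banach, second_countable_topology}"
  assumes "c \<noteq> 0" and g: "has_bochner_integral lborel g J"
  shows "has_bochner_integral lborel (\<lambda>x. g (c *\<^sub>R x)) ((1 / \<bar>c\<bar> ^ DIM('a)) *\<^sub>R J)"
proof -
  have [measurable]: "g \<in> borel_measurable borel"
    using borel_measurable_has_bochner_integral[OF g] by simp
  let ?a = "\<bar>c\<bar> ^ DIM('a)"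
  have eq: "lborel = density (distr lborel borel (\<lambda>x::'a. c *\<^sub>R x)) (\<lambda>_. ennreal ?a)"
    using lborel_affine[OF assms(1), of 0] by simp
  have "has_bochner_integral (density (distr lborel borel (\<lambda>x::'a. c *\<^sub>R x)) (\<lambda>_. ennreal ?a)) g J"
    using g eq by simp
  then have "has_bochner_integral lborel (\<lambda>x. ?a *\<^sub>R g (c *\<^sub>R x)) J"
    by (simp add: has_bochner_integral_iff integrable_density integral_density
        integrable_distr_eq integral_distr)
  from has_bochner_integral_scaleR_right[OF this, of "1 / ?a"] show ?thesis
    using assms(1) by simp
qed

text \<open>The map factors into two shears and a swap: \<open>(z, w) \<mapsto> (z, u)\<close>, then \<open>(u, z)\<close>, then
  \<open>(u, v/2)\<close> with \<open>v = 2 zbar - ubar\<close>; the factor 1/4 comes from rescaling \<open>v/2\<close>.\<close>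

lemma lborel_pair_complex_change:
  fixes f g :: "complex \<Rightarrow> complex"
  assumes f: "has_bochner_integral lborel f I" and g: "has_bochner_integral lborel g J"
  shows "has_bochner_integral lborel
    (\<lambda>(z, w). f (z + \<i> * w) * g (cnj z + \<i> * cnj w)) (I * J / 4)"
proof -
  let ?P = "lborel \<Otimes>\<^sub>M lborel :: (complex \<times> complex) measure"
  have sf: "sigma_finite_measure (lborel :: complex measure)"
    by (rule sigma_finite_lborel)
  have [measurable]: "cnj \<in> borel_measurable borel"
    by (intro borel_measurable_continuous_onI continuous_intros)
  have translate: "distr lborel borel ((+) c \<circ> T) = lborel"
    if "distr lborel borel T = lborel" and [measurable]: "T \<in> borel_measurable borel"
    for c :: complex and T
    by (subst distr_distr[symmetric, of _ borel]) (simp_all add: that(1) lborel_distr_plus)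
  have 1: "distr ?P ?P (\<lambda>(z, w). (z, z + \<i> * w)) = ?P"
  proof (rule distr_pair_shear[OF sf sf sf])
    show "distr lborel lborel (\<lambda>w. z + \<i> * w) = lborel" for z
      using translate[OF lborel_distr_mult_ii, of z] by (simp add: o_def cong: distr_cong)
  qed measurable
  have mt: "(\<lambda>(z, w). (z, z + \<i> * w)) \<in> ?P \<rightarrow>\<^sub>M ?P"
    by measurable
  have 2: "distr ?P ?P (\<lambda>(z, u). (u, z)) = ?P"
    using lborel_pair.distr_pair_swap[symmetric] by simp
  \<comment> \<open>Halving \<open>v\<close> gives \<open>cnj z\<close> the coefficient 1, so each
    slice is a conjugation followed by a translation and preserves measure.\<close>
  have 3: "distr ?P ?P (\<lambda>(u, z). (u, - cnj u / 2 + cnj z)) = ?P"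
  proof (rule distr_pair_shear[OF sf sf sf])
    show "distr lborel lborel (\<lambda>z. - cnj u / 2 + cnj z) = lborel" for u
      using translate[OF lborel_distr_cnj, of "- cnj u / 2"] by (simp add: o_def cong: distr_cong)
  qed measurable
  have "has_bochner_integral lborel (\<lambda>v. g (2 *\<^sub>R v)) (J / 4)"
    using has_bochner_integral_lborel_scaleR[OF _ g, of 2] by (simp add: scaleR_conv_of_real)
  from has_bochner_integral_pair_mult[OF sf sf f this]
  have "has_bochner_integral ?P (\<lambda>(u, v). f u * g (2 *\<^sub>R v)) (I * J / 4)"
    by simp
  \<comment> \<open>Pulling back composes the integrand with the map, so the factors of the
    substitution are used from last to first.\<close>
  from has_bochner_integral_mp[OF this 3]
  have "has_bochner_integral ?P (\<lambda>(u, z). f u * g (2 *\<^sub>R (- cnj u / 2 + cnj z))) (I * J / 4)"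
    by (simp add: case_prod_unfold)
  from has_bochner_integral_mp[OF this 2]
  have zu: "has_bochner_integral ?P (\<lambda>(z, u). f u * g (2 *\<^sub>R (- cnj u / 2 + cnj z))) (I * J / 4)"
    by (simp add: case_prod_unfold)
  have "2 *\<^sub>R (- cnj (z + \<i> * w) / 2 + cnj z) = cnj z + \<i> * cnj w" for z w
    by (simp add: scaleR_conv_of_real field_simps)
  then show ?thesis
    using has_bochner_integral_mp[OF zu 1 mt]
    by (simp only: case_prod_unfold lborel_prod fst_conv snd_conv)
qed

subsection \<open>Wirtinger derivatives\<close>

text \<open>Every real-linear map of the plane is uniquely of the form
  \<open>a * v + b * cnj v\<close>. Requiring the full derivative in this form makes the product and
  chain rules available, which derivatives along the two axes alone would not give.\<close>

definition has_wirtinger :: "(complex \<Rightarrow> complex) \<Rightarrow> complex \<Rightarrow> complex \<Rightarrow> complex \<Rightarrow> bool" where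
  "has_wirtinger f a b z \<longleftrightarrow> (f has_derivative (\<lambda>v. a * v + b * cnj v)) (at z)"

text \<open>Chain rule along a line. Directions 1 and \<open>\<i>\<close> yield the partial
  derivatives, and the same formula is later integrated over horizontal and vertical lines.\<close>

lemma has_wirtinger_along:
  assumes "has_wirtinger f a b (z + of_real t * d)"
  shows "((\<lambda>t::real. f (z + of_real t * d)) has_vector_derivative a * d + b * cnj d) (at t)"
proof -
  have "((\<lambda>t. z + complex_of_real t * d) has_derivative (\<lambda>h. of_real h * d)) (at t)"
    by (auto intro!: derivative_eq_intros)
  from has_derivative_compose[OF this, of f "\<lambda>v. a * v + b * cnj v"] assms
  have "((\<lambda>t. f (z + of_real t * d)) has_derivative
      (\<lambda>h. a * (of_real h * d) + b * cnj (of_real h * d))) (at t)"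
    by (auto simp: has_wirtinger_def)
  then show ?thesis
    by (simp add: has_vector_derivative_def scaleR_conv_of_real algebra_simps)
qed

text \<open>Directions 1 and \<open>\<i>\<close> give \<open>a + b\<close> and
  \<open>\<i> * (a - b)\<close>, from which the two Wirtinger combinations recover \<open>a\<close>
  and \<open>b\<close>.\<close>

lemma
  assumes "has_wirtinger f a b z"
  shows wirtinger_eqI: "wirtinger f z = a"
    and wirtinger_cnj_eqI: "wirtinger_cnj f z = b"
proof -
  have "partial_x f z = a + b" "partial_y f z = \<i> * (a - b)"
    using has_wirtinger_along[of f a b z 0 1] has_wirtinger_along[of f a b z 0 \<i>] assms
    by (simp_all add: partial_x_def partial_y_def vector_derivative_at algebra_simps)
  then show "wirtinger f z = a" "wirtinger_cnj f z = b"
    by (simp_all add: wirtinger_def wirtinger_cnj_def)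
qed

lemma has_wirtinger_const: "has_wirtinger (\<lambda>_. c) 0 0 z"
  by (simp add: has_wirtinger_def)

lemma has_wirtinger_id: "has_wirtinger (\<lambda>z. z) 1 0 z"
  by (simp add: has_wirtinger_def)

lemma has_wirtinger_cnj:
  assumes "has_wirtinger f a b z"
  shows "has_wirtinger (\<lambda>z. cnj (f z)) (cnj b) (cnj a) z"
  using has_derivative_cnj[OF assms[unfolded has_wirtinger_def]]
  by (simp add: has_wirtinger_def add.commute)

lemma has_wirtinger_diff:
  assumes "has_wirtinger f a b z" "has_wirtinger g c d z"
  shows "has_wirtinger (\<lambda>z. f z - g z) (a - c) (b - d) z"
  using has_derivative_diff[OF assms[unfolded has_wirtinger_def]]
  by (simp add: has_wirtinger_def algebra_simps)

lemma has_wirtinger_mult: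
  assumes "has_wirtinger f a b z" "has_wirtinger g c d z"
  shows "has_wirtinger (\<lambda>z. f z * g z) (a * g z + f z * c) (b * g z + f z * d) z"
  using has_derivative_mult[OF assms[unfolded has_wirtinger_def]]
  by (simp add: has_wirtinger_def algebra_simps)

lemma has_wirtinger_power:
  assumes "has_wirtinger f a b z"
  shows "has_wirtinger (\<lambda>z. f z ^ n) (of_nat n * a * f z ^ (n - 1)) (of_nat n * b * f z ^ (n - 1)) z"
  using has_derivative_power[OF assms[unfolded has_wirtinger_def], of n]
  by (simp add: has_wirtinger_def algebra_simps)

lemma has_wirtinger_exp:
  assumes "has_wirtinger f a b z"
  shows "has_wirtinger (\<lambda>z. exp (f z)) (a * exp (f z)) (b * exp (f z)) z"
proof -
  have "((\<lambda>z. exp (f z)) has_derivative (\<lambda>v. exp (f z) * (a * v + b * cnj v))) (at z)"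
    using has_derivative_compose[OF assms[unfolded has_wirtinger_def]
        DERIV_exp[THEN has_field_derivative_imp_has_derivative]] by simp
  then show ?thesis
    by (simp add: has_wirtinger_def algebra_simps)
qed

section \<open>The Gaussian weight and the Hermite recursion\<close>

abbreviation gauss :: "complex \<Rightarrow> complex" where
  "gauss z \<equiv> exp (- (z * cnj z))"

lemma gauss_eq: "gauss z = of_real (exp (- ((cmod z)\<^sup>2)))"
  by (simp only: complex_norm_square[symmetric] of_real_minus[symmetric] exp_of_real)

lemma has_wirtinger_gauss: "has_wirtinger gauss (- cnj z * gauss z) (- z * gauss z) z"
proof -
  have "has_wirtinger (\<lambda>z. 0 - z * cnj z) (0 - (1 * cnj z + z * cnj 0)) (0 - (0 * cnj z + z * cnj 1)) z"
    by (intro has_wirtinger_diff has_wirtinger_mult has_wirtinger_const has_wirtinger_id has_wirtinger_cnj)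
  from has_wirtinger_exp[OF this] show ?thesis
    by simp
qed

text \<open>In the recursion the value at \<open>n - 1\<close> for \<open>n = 0\<close> is harmless, as its coefficient vanishes.\<close>

primrec hermite_poly :: "nat \<Rightarrow> nat \<Rightarrow> complex \<Rightarrow> complex" where
  "hermite_poly 0 = (\<lambda>n z. cnj z ^ n)"
| "hermite_poly (Suc m) =
    (\<lambda>n z. z * hermite_poly m n z - of_nat n * hermite_poly m (n - 1) z)"

text \<open>Lowering relations, by the product rule applied to the recursion. The step uses the case
  \<open>m\<close> at both \<open>n\<close> and \<open>n - 1\<close>, hence the induction over
  arbitrary \<open>n\<close>.\<close>

lemma has_wirtinger_hermite_poly:
  "has_wirtinger (hermite_poly m n) (of_nat m * hermite_poly (m - 1) n z)
     (of_nat n * hermite_poly m (n - 1) z) z"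
proof (induction m arbitrary: n)
  case 0
  show ?case
    using has_wirtinger_power[OF has_wirtinger_cnj[OF has_wirtinger_id]] by simp
next
  case (Suc m)
  have "has_wirtinger (hermite_poly (Suc m) n)
     ((1 * hermite_poly m n z + z * (of_nat m * hermite_poly (m - 1) n z)) -
       (0 * hermite_poly m (n - 1) z + of_nat n * (of_nat m * hermite_poly (m - 1) (n - 1) z)))
     ((0 * hermite_poly m n z + z * (of_nat n * hermite_poly m (n - 1) z)) -
       (0 * hermite_poly m (n - 1) z + of_nat n * (of_nat (n - 1) * hermite_poly m (n - 1 - 1) z))) z"
    unfolding hermite_poly.simps
    by (intro has_wirtinger_diff has_wirtinger_mult has_wirtinger_id has_wirtinger_const Suc.IH)
  \<comment> \<open>For positive \<open>m\<close> the terms carrying the factor \<open>m\<close>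
    recombine, by the recursion, to \<open>of_nat m * hermite_poly m n z\<close>; for
    \<open>m = 0\<close> they vanish.\<close>
  moreover have "(1 * hermite_poly m n z + z * (of_nat m * hermite_poly (m - 1) n z)) -
       (0 * hermite_poly m (n - 1) z + of_nat n * (of_nat m * hermite_poly (m - 1) (n - 1) z))
     = of_nat (Suc m) * hermite_poly (Suc m - 1) n z"
    by (cases m) (simp_all add: algebra_simps)
  moreover have "(0 * hermite_poly m n z + z * (of_nat n * hermite_poly m (n - 1) z)) -
       (0 * hermite_poly m (n - 1) z + of_nat n * (of_nat (n - 1) * hermite_poly m (n - 1 - 1) z))
     = of_nat n * hermite_poly (Suc m) (n - 1) z"
    by (simp add: algebra_simps)
  ultimately show ?case
    by simp
qed

text \<open>This derivative treats \<open>cnj z\<close> as a constant, so each application only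
  brings down a factor \<open>- cnj z\<close> from the Gaussian.\<close>

lemma wirtinger_pow_gauss: "(wirtinger ^^ n) gauss = (\<lambda>z. (-1) ^ n * cnj z ^ n * gauss z)"
proof (induction n)
  case (Suc n)
  have "wirtinger (\<lambda>z. (-1) ^ n * cnj z ^ n * gauss z) z = (-1) ^ Suc n * cnj z ^ Suc n * gauss z" for z
  proof -
    have "has_wirtinger (\<lambda>z. (-1) ^ n * cnj z ^ n * gauss z)
        ((0 * cnj z ^ n + (-1) ^ n * (of_nat n * cnj 0 * cnj z ^ (n - 1))) * gauss z +
          (-1) ^ n * cnj z ^ n * (- cnj z * gauss z))
        ((0 * cnj z ^ n + (-1) ^ n * (of_nat n * cnj 1 * cnj z ^ (n - 1))) * gauss z +
          (-1) ^ n * cnj z ^ n * (- z * gauss z)) z"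
      by (rule has_wirtinger_mult has_wirtinger_const has_wirtinger_power has_wirtinger_cnj
          has_wirtinger_id has_wirtinger_gauss)+
    from wirtinger_eqI[OF this] show ?thesis
      by simp
  qed
  then show ?case
    by (simp add: Suc.IH fun_eq_iff)
qed simp

text \<open>This explains the recursion for \<open>hermite_poly\<close>: the polynomial contributes
  \<open>of_nat n * hermite_poly m (n - 1) z\<close>, the Gaussian contributes
  \<open>- z * hermite_poly m n z\<close>, and their sum is
  \<open>- hermite_poly (Suc m) n z\<close>.\<close>

lemma wirtinger_cnj_pow_gauss:
  "(wirtinger_cnj ^^ m) ((wirtinger ^^ n) gauss) =
    (\<lambda>z. (-1) ^ (m + n) * hermite_poly m n z * gauss z)"
proof (induction m)
  case 0
  show ?case
    by (simp add: wirtinger_pow_gauss)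
next
  case (Suc m)
  have "wirtinger_cnj (\<lambda>z. (-1) ^ (m + n) * hermite_poly m n z * gauss z) z =
      (-1) ^ (Suc m + n) * hermite_poly (Suc m) n z * gauss z" for z
  proof -
    have "has_wirtinger (\<lambda>z. (-1) ^ (m + n) * hermite_poly m n z * gauss z)
        ((0 * hermite_poly m n z + (-1) ^ (m + n) * (of_nat m * hermite_poly (m - 1) n z)) * gauss z +
          (-1) ^ (m + n) * hermite_poly m n z * (- cnj z * gauss z))
        ((0 * hermite_poly m n z + (-1) ^ (m + n) * (of_nat n * hermite_poly m (n - 1) z)) * gauss z +
          (-1) ^ (m + n) * hermite_poly m n z * (- z * gauss z)) z"
      by (intro has_wirtinger_mult has_wirtinger_const has_wirtinger_hermite_poly has_wirtinger_gauss)
    from wirtinger_cnj_eqI[OF this] show ?thesis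
      by (simp add: algebra_simps)
  qed
  then show ?case
    by (simp add: Suc.IH fun_eq_iff)
qed

lemma hermite_uni_eq: "hermite_uni m n z = hermite_poly m n z"
proof -
  have "hermite_uni m n z = (-1) ^ (m + n) * of_real (exp ((cmod z)\<^sup>2)) *
      ((-1) ^ (m + n) * hermite_poly m n z * of_real (exp (- ((cmod z)\<^sup>2))))"
    unfolding hermite_uni_def gauss_eq[symmetric] wirtinger_cnj_pow_gauss ..
  also have "\<dots> = ((-1) ^ (m + n) * (-1) ^ (m + n)) * hermite_poly m n z *
      of_real (exp ((cmod z)\<^sup>2) * exp (- ((cmod z)\<^sup>2)))"
    by (simp add: mult_ac)
  also have "\<dots> = hermite_poly m n z"
    unfolding power_mult_distrib[symmetric] mult_exp_exp by simp
  finally show ?thesis .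
qed

subsection \<open>Gaussian integrals on the complex plane\<close>

text \<open>A class closed under ring operations and conjugation, so it contains every factor that
  multiplies the Gaussian below. The base \<open>1 + cmod z\<close> is at least 1, which lets
  exponents be raised to a common one; continuity supplies measurability.\<close>

definition poly_growth :: "(complex \<Rightarrow> complex) \<Rightarrow> bool" where
  "poly_growth f \<longleftrightarrow> continuous_on UNIV f \<and> (\<exists>C k. \<forall>z. cmod (f z) \<le> C * (1 + cmod z) ^ k)"

lemma poly_growthE:
  assumes "poly_growth f"
  obtains C k where "C \<ge> 0" "\<And>z. cmod (f z) \<le> C * (1 + cmod z) ^ k"
proof -
  obtain C k where *: "\<And>z. cmod (f z) \<le> C * (1 + cmod z) ^ k"
    using assms by (auto simp: poly_growth_def)
  have "0 \<le> C"
    using order_trans[OF norm_ge_zero *[of 0]] by simp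
  then show ?thesis
    using * that by blast
qed

lemma poly_growth_const: "poly_growth (\<lambda>_. c)"
  unfolding poly_growth_def by (intro conjI continuous_intros exI[of _ "cmod c"] exI[of _ 0]) simp

lemma poly_growth_id: "poly_growth (\<lambda>z. z)"
  unfolding poly_growth_def by (intro conjI continuous_intros exI[of _ 1]) simp

lemma poly_growth_cnj: "poly_growth f \<Longrightarrow> poly_growth (\<lambda>z. cnj (f z))"
  by (auto simp: poly_growth_def intro!: continuous_intros)

lemma poly_growth_mult:
  assumes "poly_growth f" "poly_growth g"
  shows "poly_growth (\<lambda>z. f z * g z)"
proof -
  obtain C k where f: "C \<ge> 0" "\<And>z. cmod (f z) \<le> C * (1 + cmod z) ^ k"
    using poly_growthE[OF assms(1)] by blast
  obtain D l where g: "D \<ge> 0" "\<And>z. cmod (g z) \<le> D * (1 + cmod z) ^ l"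
    using poly_growthE[OF assms(2)] by blast
  have "cmod (f z * g z) \<le> (C * D) * (1 + cmod z) ^ (k + l)" for z
    using mult_mono[OF f(2) g(2), of z z] f(1)
    by (simp add: norm_mult power_add mult_ac)
  then show ?thesis
    using assms by (auto simp: poly_growth_def intro!: continuous_intros)
qed

lemma poly_growth_add:
  assumes "poly_growth f" "poly_growth g"
  shows "poly_growth (\<lambda>z. f z + g z)"
proof -
  obtain C k where f: "C \<ge> 0" "\<And>z. cmod (f z) \<le> C * (1 + cmod z) ^ k"
    using poly_growthE[OF assms(1)] by blast
  obtain D l where g: "D \<ge> 0" "\<And>z. cmod (g z) \<le> D * (1 + cmod z) ^ l"
    using poly_growthE[OF assms(2)] by blast
  have "cmod (f z + g z) \<le> (C + D) * (1 + cmod z) ^ (k + l)" for z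
  proof -
    have "cmod (f z + g z) \<le> C * (1 + cmod z) ^ k + D * (1 + cmod z) ^ l"
      using norm_triangle_ineq[of "f z" "g z"] f(2)[of z] g(2)[of z] by linarith
    also have "\<dots> \<le> C * (1 + cmod z) ^ (k + l) + D * (1 + cmod z) ^ (k + l)"
      using f(1) g(1) by (intro add_mono mult_left_mono power_increasing) auto
    finally show ?thesis
      by (simp add: algebra_simps)
  qed
  then show ?thesis
    using assms by (auto simp: poly_growth_def intro!: continuous_intros)
qed

lemma poly_growth_diff:
  assumes "poly_growth f" "poly_growth g"
  shows "poly_growth (\<lambda>z. f z - g z)"
  using poly_growth_add[OF assms(1) poly_growth_mult[OF poly_growth_const[of "-1"] assms(2)]]
  by simp

lemma poly_growth_power: "poly_growth f \<Longrightarrow> poly_growth (\<lambda>z. f z ^ n)"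
  by (induction n) (auto intro: poly_growth_const poly_growth_mult)

lemmas poly_growth_intros = poly_growth_const poly_growth_id poly_growth_cnj poly_growth_mult
  poly_growth_add poly_growth_diff poly_growth_power

lemma poly_growth_hermite_poly: "poly_growth (hermite_poly m n)"
  by (induction m arbitrary: n) (auto intro!: poly_growth_intros)

text \<open>With \<open>r = cmod z\<close>, \<open>1 + r \<le> exp r\<close> turns the power into
  \<open>exp (k * r)\<close>, and \<open>k * r \<le> k^2 / 2 + r^2 / 2\<close> absorbs it at the
  cost of half the Gaussian decay and a constant \<open>exp (k^2 / 2)\<close>.\<close>

lemma poly_growth_gauss_bound:
  assumes "poly_growth f"
  obtains C where "\<And>z. cmod (f z * gauss z) \<le> C * exp (- ((cmod z)\<^sup>2) / 2)"
proof -
  obtain C k where f: "C \<ge> 0" "\<And>z. cmod (f z) \<le> C * (1 + cmod z) ^ k"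
    using poly_growthE[OF assms] by blast
  have "cmod (f z * gauss z) \<le> (C * exp ((real k)\<^sup>2 / 2)) * exp (- ((cmod z)\<^sup>2) / 2)" for z
  proof -
    let ?r = "cmod z"
    have "(1 + ?r) ^ k \<le> exp ?r ^ k"
      by (intro power_mono) (auto simp: exp_ge_add_one_self)
    from mult_left_mono[OF this f(1)] have "cmod (f z) \<le> C * exp (real k * ?r)"
      unfolding exp_of_nat_mult by (rule order_trans[OF f(2)])
    then have "cmod (f z * gauss z) \<le> C * exp (real k * ?r) * exp (- (?r\<^sup>2))"
      unfolding gauss_eq norm_mult by simp
    also have "\<dots> = C * exp (real k * ?r - ?r\<^sup>2)"
      by (simp add: mult_exp_exp)
    also have "\<dots> \<le> C * exp ((real k)\<^sup>2 / 2 - ?r\<^sup>2 / 2)"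
    proof -
      have "real k * ?r - ?r\<^sup>2 \<le> (real k)\<^sup>2 / 2 - ?r\<^sup>2 / 2"
        using zero_le_power2[of "real k - ?r"] by (simp add: power2_diff)
      then show ?thesis
        using f(1) by (intro mult_left_mono) auto
    qed
    also have "\<dots> = (C * exp ((real k)\<^sup>2 / 2)) * exp (- (?r\<^sup>2) / 2)"
      by (simp add: mult_exp_exp)
    finally show ?thesis .
  qed
  then show ?thesis
    using that by blast
qed

section \<open>Integration over the plane in real coordinates\<close>

lemma has_bochner_integral_lborel_complexI:
  fixes f :: "complex \<Rightarrow> 'a::{banach, second_countable_topology}"
  assumes [measurable]: "f \<in> borel_measurable borel"
    and f: "has_bochner_integral (lborel \<Otimes>\<^sub>M lborel) (\<lambda>(x, y). f (Complex x y)) I"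
  shows "has_bochner_integral lborel f I"
proof -
  have "(\<lambda>(x, y). Complex x y) \<in> borel_measurable borel"
    unfolding case_prod_unfold Complex_eq by (intro borel_measurable_continuous_onI continuous_intros)
  then show ?thesis
    using f by (subst lborel_distr_Complex[symmetric], intro has_bochner_integral_distr)
      (simp_all add: lborel_prod case_prod_unfold)
qed

lemma has_bochner_integral_lborel_complexD:
  fixes f :: "complex \<Rightarrow> 'a::{banach, second_countable_topology}"
  assumes "has_bochner_integral lborel f I"
  shows "has_bochner_integral (lborel \<Otimes>\<^sub>M lborel) (\<lambda>(x, y). f (Complex x y)) I"
proof -
  have "(\<lambda>(x, y). Complex x y) \<in> borel_measurable borel"
    unfolding case_prod_unfold Complex_eq by (intro borel_measurable_continuous_onI continuous_intros)
  moreover have "distr lborel lborel (\<lambda>(x, y). Complex x y) = lborel"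
    using lborel_distr_Complex by (simp cong: distr_cong)
  ultimately show ?thesis
    using has_bochner_integral_mp[OF assms, where T = "\<lambda>(x, y). Complex x y" and M = lborel]
    by (simp add: lborel_prod case_prod_unfold)
qed

text \<open>Product of two normal densities without their normalising constants. The width stays
  free because \<open>\<sigma> = 1\<close> gives the dominating function and
  \<open>\<sigma> = 1 / sqrt 2\<close> the weight itself.\<close>

lemma has_bochner_integral_gaussian_complex:
  assumes "\<sigma> > 0"
  shows "has_bochner_integral lborel (\<lambda>z. exp (- ((cmod z)\<^sup>2) / (2 * \<sigma>\<^sup>2))) (2 * pi * \<sigma>\<^sup>2)"
proof (rule has_bochner_integral_lborel_complexI)
  have "has_bochner_integral lborel (normal_density 0 \<sigma>) 1"
    using assms by (simp add: has_bochner_integral_iff)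
  from has_bochner_integral_mult_right[OF this, of "sqrt (2 * pi * \<sigma>\<^sup>2)"]
  have "has_bochner_integral lborel (\<lambda>x. exp (- (x\<^sup>2) / (2 * \<sigma>\<^sup>2))) (sqrt (2 * pi * \<sigma>\<^sup>2))"
    using assms by (simp add: normal_density_def)
  from has_bochner_integral_pair_mult[OF sigma_finite_lborel sigma_finite_lborel this this]
  show "has_bochner_integral (lborel \<Otimes>\<^sub>M lborel)
      (\<lambda>(x, y). exp (- ((cmod (Complex x y))\<^sup>2) / (2 * \<sigma>\<^sup>2))) (2 * pi * \<sigma>\<^sup>2)"
    using assms by (simp add: cmod_power2 mult_exp_exp add_divide_distrib diff_divide_distrib)
qed simp

lemma
  assumes f: "poly_growth f"
  shows integrable_poly_growth_gauss: "integrable lborel (\<lambda>z. f z * gauss z)"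
    and tendsto_poly_growth_gauss: "((\<lambda>z. f z * gauss z) \<longlongrightarrow> 0) at_infinity"
proof -
  obtain C where C: "\<And>z. cmod (f z * gauss z) \<le> C * exp (- ((cmod z)\<^sup>2) / 2)"
    using poly_growth_gauss_bound[OF f] by blast
  have "integrable lborel (\<lambda>z. C * exp (- ((cmod z)\<^sup>2) / 2))"
    using has_bochner_integral_gaussian_complex[of 1] by (simp add: has_bochner_integral_iff)
  moreover have "(\<lambda>z. f z * gauss z) \<in> borel_measurable lborel"
    using borel_measurable_continuous_onI[of "\<lambda>z. f z * gauss z"] f
    by (simp add: poly_growth_def continuous_intros)
  ultimately show "integrable lborel (\<lambda>z. f z * gauss z)"
    by (rule Bochner_Integration.integrable_bound) (rule AE_I2, rule order_trans[OF C], simp)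
  have "((\<lambda>r::real. C * exp (- (r\<^sup>2) / 2)) \<longlongrightarrow> 0) at_top"
    by real_asymp
  then have "((\<lambda>z::complex. C * exp (- ((cmod z)\<^sup>2) / 2)) \<longlongrightarrow> 0) at_infinity"
    by (rule filterlim_compose) (rule filterlim_norm_at_top)
  then show "((\<lambda>z. f z * gauss z) \<longlongrightarrow> 0) at_infinity"
    by (rule Lim_null_comparison[rotated]) (use C in simp)
qed

section \<open>Vanishing integrals of derivatives\<close>

lemma lborel_integral_deriv_eq_0:
  fixes F f :: "real \<Rightarrow> complex"
  assumes "\<And>x. (F has_vector_derivative f x) (at x)" "\<And>x. isCont f x" "integrable lborel f"
    and "(F \<longlongrightarrow> 0) at_top" "(F \<longlongrightarrow> 0) at_bot"
  shows "(LINT x|lborel. f x) = 0"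
proof -
  have "(LBINT x=-\<infinity>..\<infinity>. f x) = 0 - 0"
  proof (rule interval_integral_FTC_integrable)
    show "((F \<circ> real_of_ereal) \<longlongrightarrow> 0) (at_right (-\<infinity>))" "((F \<circ> real_of_ereal) \<longlongrightarrow> 0) (at_left \<infinity>)"
      using assms(4,5) by (simp_all add: ereal_tendsto_simps)
  qed (use assms in \<open>auto simp: set_integrable_def\<close>)
  then show ?thesis
    by (simp add: interval_integral_to_infinity_eq interval_lebesgue_integral_def set_lebesgue_integral_def)
qed

lemma filterlim_line_at_infinity:
  fixes z d :: complex
  assumes "d \<noteq> 0"
  shows "filterlim (\<lambda>t::real. z + of_real t * d) at_infinity at_top"
    and "filterlim (\<lambda>t::real. z + of_real t * d) at_infinity at_bot"
proof -
  have *: "filterlim (\<lambda>t::real. z + of_real t * d) at_infinity F"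
    if "filterlim (\<lambda>t::real. t) at_infinity F" for F
  proof -
    have "filterlim (\<lambda>t. of_real t :: complex) at_infinity F"
      using that by (simp add: filterlim_at_infinity_conv_norm_at_top)
    with assms have "filterlim (\<lambda>t. d * of_real t) at_infinity F"
      by (intro tendsto_mult_filterlim_at_infinity[of "\<lambda>_. d" d] tendsto_const)
    then show ?thesis
      by (intro tendsto_add_filterlim_at_infinity[of "\<lambda>_. z" z] tendsto_const)
        (simp add: mult.commute)
  qed
  show "filterlim (\<lambda>t::real. z + of_real t * d) at_infinity at_top"
    by (rule *) (rule filterlim_at_top_imp_at_infinity, rule filterlim_ident)
  show "filterlim (\<lambda>t::real. z + of_real t * d) at_infinity at_bot"
    by (rule *) (rule filterlim_at_bot_imp_at_infinity, rule filterlim_ident)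
qed

text \<open>Fubini reduces both claims to lines: \<open>a + b\<close> is the derivative of
  \<open>G\<close> in direction 1 and \<open>a * \<i> + b * cnj \<i>\<close> that in direction
  \<open>\<i>\<close>. Each integrates to 0 along lines because \<open>G\<close> decays, so the
  integrals of \<open>a\<close> and \<open>b\<close> have both sum and difference 0.\<close>

lemma
  assumes G: "\<And>z. has_wirtinger G (a z) (b z) z"
    and cont: "continuous_on UNIV a" "continuous_on UNIV b"
    and int: "integrable lborel a" "integrable lborel b"
    and lim: "(G \<longlongrightarrow> 0) at_infinity"
  shows integral_wirtinger_eq_0: "(LINT z|lborel. a z) = 0"
    and integral_wirtinger_cnj_eq_0: "(LINT z|lborel. b z) = 0"
proof -
  have line: "(LINT t|lborel. a (z + of_real t * d) * d + b (z + of_real t * d) * cnj d) = 0"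
    if "d \<noteq> 0" "integrable lborel (\<lambda>t. a (z + of_real t * d) * d + b (z + of_real t * d) * cnj d)" for z d
  proof (rule lborel_integral_deriv_eq_0)
    show "((\<lambda>t. G (z + of_real t * d)) has_vector_derivative
        a (z + of_real t * d) * d + b (z + of_real t * d) * cnj d) (at t)" for t
      by (rule has_wirtinger_along) (rule G)
    have "continuous_on UNIV (\<lambda>t. z + of_real t * d)"
      by (intro continuous_intros)
    from continuous_on_compose2[OF cont(1) this] continuous_on_compose2[OF cont(2) this]
    have "continuous_on UNIV (\<lambda>t. a (z + of_real t * d) * d + b (z + of_real t * d) * cnj d)"
      by (intro continuous_on_add continuous_on_mult continuous_on_const) auto
    then show "isCont (\<lambda>t. a (z + of_real t * d) * d + b (z + of_real t * d) * cnj d) t" for t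
      by (simp add: continuous_on_eq_continuous_at)
    show "((\<lambda>t. G (z + of_real t * d)) \<longlongrightarrow> 0) at_top" "((\<lambda>t. G (z + of_real t * d)) \<longlongrightarrow> 0) at_bot"
      using filterlim_line_at_infinity[OF that(1)] by (auto intro: filterlim_compose[OF lim])
  qed (rule that(2))
  have X: "(LINT z|lborel. a z + b z) = 0"
  proof -
    let ?g = "\<lambda>(x, y). a (Complex x y) + b (Complex x y)"
    have 1: "has_bochner_integral (lborel \<Otimes>\<^sub>M lborel) ?g (LINT z|lborel. a z + b z)"
      by (rule has_bochner_integral_lborel_complexD) (use int in \<open>auto simp: has_bochner_integral_iff\<close>)
    then have "(LINT z|lborel. a z + b z) = (LINT y|lborel. LINT x|lborel. ?g (x, y))"
      using lborel_pair.integral_snd[of "\<lambda>x y. ?g (x, y)"] by (simp add: has_bochner_integral_iff)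
    also have "\<dots> = 0"
    proof (rule integral_eq_zero_AE)
      \<comment> \<open>Integrability on the plane passes only to almost every line, which suffices
        for the outer integral.\<close>
      have "AE y in lborel. integrable lborel (\<lambda>x. ?g (x, y))"
        using 1 lborel_pair.AE_integrable_snd[of "\<lambda>x y. ?g (x, y)"] by (simp add: has_bochner_integral_iff)
      then show "AE y in lborel. (LINT x|lborel. ?g (x, y)) = 0"
        by eventually_elim (use line[of 1 "\<i> * of_real _"] in \<open>simp add: Complex_eq add.commute\<close>)
    qed
    finally show ?thesis .
  qed
  \<comment> \<open>Here the vertical variable is integrated first, whereas the previous step
    integrated the horizontal one first.\<close>
  have Y: "(LINT z|lborel. a z * \<i> + b z * cnj \<i>) = 0"
  proof -
    let ?g = "\<lambda>(x, y). a (Complex x y) * \<i> + b (Complex x y) * cnj \<i>"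
    have 1: "has_bochner_integral (lborel \<Otimes>\<^sub>M lborel) ?g (LINT z|lborel. a z * \<i> + b z * cnj \<i>)"
      by (rule has_bochner_integral_lborel_complexD) (use int in \<open>auto simp: has_bochner_integral_iff\<close>)
    then have "(LINT z|lborel. a z * \<i> + b z * cnj \<i>) = (LINT x|lborel. LINT y|lborel. ?g (x, y))"
      using lborel_pair.integral_fst[of "\<lambda>x y. ?g (x, y)"] by (simp add: has_bochner_integral_iff)
    also have "\<dots> = 0"
    proof (rule integral_eq_zero_AE)
      have "AE x in lborel. integrable lborel (\<lambda>y. ?g (x, y))"
        using 1 lborel_pair.AE_integrable_fst[of "\<lambda>x y. ?g (x, y)"] by (simp add: has_bochner_integral_iff)
      then show "AE x in lborel. (LINT y|lborel. ?g (x, y)) = 0"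
        by eventually_elim (use line[of \<i> "of_real _"] in \<open>simp add: Complex_eq mult.commute\<close>)
    qed
    finally show ?thesis .
  qed
  have sum: "(LINT z|lborel. a z) + (LINT z|lborel. b z) = 0"
    using X int by simp
  have "(LINT z|lborel. a z) - (LINT z|lborel. b z) = 0"
    using Y int by (simp add: left_diff_distrib[symmetric])
  then have eq: "(LINT z|lborel. a z) = (LINT z|lborel. b z)"
    by (rule eq_iff_diff_eq_0[THEN iffD2])
  from sum show "(LINT z|lborel. b z) = 0"
    unfolding eq mult_2[symmetric] by (simp only: mult_eq_0_iff) simp
  then show "(LINT z|lborel. a z) = 0"
    by (simp only: eq)
qed

subsection \<open>Orthogonality\<close>

definition hermite_inner :: "nat \<Rightarrow> nat \<Rightarrow> nat \<Rightarrow> nat \<Rightarrow> complex" where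
  "hermite_inner m n p q =
    (LINT z|lborel. hermite_poly m n z * cnj (hermite_poly p q z) * gauss z)"

lemma integrable_hermite_inner:
  "integrable lborel (\<lambda>z. hermite_poly m n z * cnj (hermite_poly p q z) * gauss z)"
  by (intro integrable_poly_growth_gauss poly_growth_intros poly_growth_hermite_poly)

text \<open>The weight is real. This symmetry carries recursions in the left pair of indices over to
  the right pair.\<close>

lemma hermite_inner_commute: "hermite_inner p q m n = cnj (hermite_inner m n p q)"
  unfolding hermite_inner_def Bochner_Integration.integral_cnj[symmetric]
  by (rule Bochner_Integration.integral_cong) (simp_all add: exp_cnj mult_ac)

text \<open>Integration by parts: the integrands are the two Wirtinger derivatives of
  \<open>f z * gauss z\<close>, which tends to 0 at infinity.\<close>

lemma
  assumes "poly_growth f" "poly_growth a" "poly_growth b" 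
    and f: "\<And>z. has_wirtinger f (a z) (b z) z"
  shows integral_wirtinger_gauss: "(LINT z|lborel. (a z - cnj z * f z) * gauss z) = 0"
    and integral_wirtinger_cnj_gauss: "(LINT z|lborel. (b z - z * f z) * gauss z) = 0"
proof -
  have pg: "poly_growth (\<lambda>z. a z - cnj z * f z)" "poly_growth (\<lambda>z. b z - z * f z)"
    by (intro poly_growth_intros assms)+
  have deriv: "has_wirtinger (\<lambda>z. f z * gauss z) ((a z - cnj z * f z) * gauss z) ((b z - z * f z) * gauss z) z" for z
    using has_wirtinger_mult[OF f has_wirtinger_gauss, of z] by (simp add: algebra_simps)
  have cont: "continuous_on UNIV (\<lambda>z. (a z - cnj z * f z) * gauss z)"
    "continuous_on UNIV (\<lambda>z. (b z - z * f z) * gauss z)"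
    using pg unfolding poly_growth_def by (auto intro!: continuous_intros)
  note rules = deriv cont integrable_poly_growth_gauss[OF pg(1)] integrable_poly_growth_gauss[OF pg(2)]
    tendsto_poly_growth_gauss[OF assms(1)]
  show "(LINT z|lborel. (a z - cnj z * f z) * gauss z) = 0"
    by (rule integral_wirtinger_eq_0[OF rules])
  show "(LINT z|lborel. (b z - z * f z) * gauss z) = 0"
    by (rule integral_wirtinger_cnj_eq_0[OF rules])
qed

text \<open>Conjugation exchanges the two derivatives. Hence on the product the derivative in the
  conjugate variable lowers \<open>n\<close> and \<open>p\<close>, while the other lowers
  \<open>m\<close> and \<open>q\<close>.\<close>

lemma
  shows integral_mult_hermite: "(LINT z|lborel. z * (hermite_poly m n z * cnj (hermite_poly p q z)) * gauss z) =
      of_nat n * hermite_inner m (n - 1) p q + of_nat p * hermite_inner m n (p - 1) q" (is ?A)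
    and integral_cnj_mult_hermite: "(LINT z|lborel. cnj z * (hermite_poly m n z * cnj (hermite_poly p q z)) * gauss z) =
      of_nat m * hermite_inner (m - 1) n p q + of_nat q * hermite_inner m n p (q - 1)" (is ?B)
proof -
  let ?h = hermite_poly
  let ?f = "\<lambda>z. ?h m n z * cnj (?h p q z)"
  let ?a = "\<lambda>z. of_nat m * ?h (m - 1) n z * cnj (?h p q z) + ?h m n z * cnj (of_nat q * ?h p (q - 1) z)"
  let ?b = "\<lambda>z. of_nat n * ?h m (n - 1) z * cnj (?h p q z) + ?h m n z * cnj (of_nat p * ?h (p - 1) q z)"
  have pg: "poly_growth ?f" "poly_growth ?a" "poly_growth ?b"
    by (intro poly_growth_intros poly_growth_hermite_poly)+
  have deriv: "has_wirtinger ?f (?a z) (?b z) z" for z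
    by (intro has_wirtinger_mult has_wirtinger_cnj has_wirtinger_hermite_poly)
  have int: "integrable lborel (\<lambda>z. z * ?f z * gauss z)" "integrable lborel (\<lambda>z. cnj z * ?f z * gauss z)"
    by (intro integrable_poly_growth_gauss poly_growth_intros poly_growth_hermite_poly)+
  note lin = integrable_mult_right integrable_hermite_inner int integral_mult_right_zero
  have "0 = (LINT z|lborel. (?b z - z * ?f z) * gauss z)"
    by (rule integral_wirtinger_cnj_gauss[OF pg deriv, symmetric])
  also have "\<dots> = (LINT z|lborel. (of_nat n * (?h m (n - 1) z * cnj (?h p q z) * gauss z) +
      of_nat p * (?h m n z * cnj (?h (p - 1) q z) * gauss z)) - z * ?f z * gauss z)"
    by (rule Bochner_Integration.integral_cong) (simp_all add: algebra_simps)
  also have "\<dots> = of_nat n * hermite_inner m (n - 1) p q + of_nat p * hermite_inner m n (p - 1) q -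
      (LINT z|lborel. z * ?f z * gauss z)"
    unfolding hermite_inner_def
    by (simp only: lin Bochner_Integration.integral_diff Bochner_Integration.integral_add
        Bochner_Integration.integrable_add)
  finally show ?A
    by simp
  have "0 = (LINT z|lborel. (?a z - cnj z * ?f z) * gauss z)"
    by (rule integral_wirtinger_gauss[OF pg deriv, symmetric])
  also have "\<dots> = (LINT z|lborel. (of_nat m * (?h (m - 1) n z * cnj (?h p q z) * gauss z) +
      of_nat q * (?h m n z * cnj (?h p (q - 1) z) * gauss z)) - cnj z * ?f z * gauss z)"
    by (rule Bochner_Integration.integral_cong) (simp_all add: algebra_simps)
  also have "\<dots> = of_nat m * hermite_inner (m - 1) n p q + of_nat q * hermite_inner m n p (q - 1) -
      (LINT z|lborel. cnj z * ?f z * gauss z)"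
    unfolding hermite_inner_def
    by (simp only: lin Bochner_Integration.integral_diff Bochner_Integration.integral_add
        Bochner_Integration.integrable_add)
  finally show ?B
    by simp
qed

text \<open>The term subtracted in the recursion for \<open>hermite_poly (Suc m) n\<close> cancels
  exactly the \<open>n\<close> term from integration by parts, leaving only the \<open>p\<close>
  term.\<close>

lemma hermite_inner_Suc:
  "hermite_inner (Suc m) n p q = of_nat p * hermite_inner m n (p - 1) q"
proof -
  let ?f = "\<lambda>z. hermite_poly m n z * cnj (hermite_poly p q z)"
  have int: "integrable lborel (\<lambda>z. z * ?f z * gauss z)"
    by (intro integrable_poly_growth_gauss poly_growth_intros poly_growth_hermite_poly)
  have "hermite_inner (Suc m) n p q = (LINT z|lborel. z * ?f z * gauss z -
      of_nat n * (hermite_poly m (n - 1) z * cnj (hermite_poly p q z) * gauss z))"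
    unfolding hermite_inner_def
    by (rule Bochner_Integration.integral_cong) (simp_all add: algebra_simps)
  also have "\<dots> = (LINT z|lborel. z * ?f z * gauss z) - of_nat n * hermite_inner m (n - 1) p q"
    unfolding hermite_inner_def
    by (simp only: int integrable_mult_right integrable_hermite_inner integral_mult_right_zero
        Bochner_Integration.integral_diff)
  finally show ?thesis
    by (simp add: integral_mult_hermite)
qed

text \<open>With first index 0 the polynomial is a power of \<open>cnj z\<close>, so raising
  \<open>n\<close> is multiplication by \<open>cnj z\<close>, and the term with coefficient
  \<open>m\<close> is absent.\<close>

lemma hermite_inner_0_Suc:
  "hermite_inner 0 (Suc n) 0 q = of_nat q * hermite_inner 0 n 0 (q - 1)"
  using integral_cnj_mult_hermite[of 0 n 0 q] by (simp add: hermite_inner_def mult_ac)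

lemma hermite_inner_0_0: "hermite_inner 0 0 0 0 = of_real pi"
proof -
  have "has_bochner_integral lborel (\<lambda>z::complex. exp (- ((cmod z)\<^sup>2))) pi"
    \<comment> \<open>This width satisfies \<open>2 * \<sigma>^2 = 1\<close>.\<close>
    using has_bochner_integral_gaussian_complex[of "1 / sqrt 2"] by (simp add: power_divide)
  then have "(LINT z|lborel. complex_of_real (exp (- ((cmod z)\<^sup>2)))) = of_real pi"
    by (intro has_bochner_integral_integral_eq has_bochner_integral_of_real)
  then show ?thesis
    unfolding hermite_inner_def gauss_eq
    by (simp only: hermite_poly.simps power_0 complex_cnj_one mult_1_left)
qed

lemma hermite_inner_0_left: "hermite_inner 0 n 0 q = of_real (pi * fact n * of_bool (n = q))"
proof (induction n arbitrary: q)
  case 0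
  \<comment> \<open>Symmetry moves the successor to the left, where the recursion produces the
    coefficient 0.\<close>
  have "hermite_inner 0 0 0 (Suc r) = 0" for r
    by (subst hermite_inner_commute) (simp add: hermite_inner_0_Suc)
  then show ?case
    by (cases q) (simp_all add: hermite_inner_0_0)
next
  case (Suc n)
  then show ?case
    by (cases q) (auto simp: hermite_inner_0_Suc)
qed

text \<open>Lowering \<open>m\<close> and \<open>p\<close> together collects the factors of
  \<open>fact m\<close>. If they reach 0 at different times the value is 0; otherwise the case of
  first indices 0 decides.\<close>

lemma hermite_inner_eq:
  "hermite_inner m n p q = of_real (pi * (fact m * fact n) * of_bool (m = p \<and> n = q))"
proof (induction m arbitrary: p)
  case 0
  have "hermite_inner 0 n (Suc r) q = 0" for r
    by (subst hermite_inner_commute) (simp add: hermite_inner_Suc)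
  then show ?case
    by (cases p) (simp_all add: hermite_inner_0_left)
next
  case (Suc m)
  then show ?case
    by (cases p) (auto simp: hermite_inner_Suc)
qed

text \<open>\<open>has_bochner_integral\<close> asserts integrability along with the value, so the
  equation does not rest on the default value of an undefined integral.\<close>

theorem theorem3p1:
  fixes m\<^sub>1 m\<^sub>2 m\<^sub>1' m\<^sub>2' n\<^sub>1 n\<^sub>2 n\<^sub>1' n\<^sub>2' :: nat
  shows "has_bochner_integral (lborel :: (complex \<times> complex) measure)
    (\<lambda>(z, w). hermite_biv m\<^sub>1 m\<^sub>2 m\<^sub>1' m\<^sub>2' z w * cnj (hermite_biv n\<^sub>1 n\<^sub>2 n\<^sub>1' n\<^sub>2' z w) *
       of_real (exp (- 2 * ((cmod z)\<^sup>2 + (cmod w)\<^sup>2))))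
    (of_real (pi\<^sup>2 / 4 * (fact m\<^sub>1 * fact m\<^sub>2 * fact m\<^sub>1' * fact m\<^sub>2') *
       of_bool ((m\<^sub>1, m\<^sub>2, m\<^sub>1', m\<^sub>2') = (n\<^sub>1, n\<^sub>2, n\<^sub>1', n\<^sub>2'))))"
proof -
  let ?F = "\<lambda>m n p q z. hermite_poly m n z * cnj (hermite_poly p q z) * gauss z"
  have F: "has_bochner_integral lborel (?F m n p q) (hermite_inner m n p q)" for m n p q
    using integrable_hermite_inner by (simp add: has_bochner_integral_iff hermite_inner_def)
  \<comment> \<open>The cross terms \<open>\<i> * w * cnj z\<close> and
    \<open>- \<i> * z * cnj w\<close> of the first square modulus occur with opposite signs in the
    second.\<close>
  have gauss: "gauss (z + \<i> * w) * gauss (cnj z + \<i> * cnj w) =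
      of_real (exp (- 2 * ((cmod z)\<^sup>2 + (cmod w)\<^sup>2)))" for z w
    unfolding of_real_exp mult_exp_exp
    by (simp add: complex_norm_square algebra_simps del: of_real_power)
  have eq: "?F m\<^sub>1 m\<^sub>2 n\<^sub>1 n\<^sub>2 (z + \<i> * w) * ?F m\<^sub>1' m\<^sub>2' n\<^sub>1' n\<^sub>2' (cnj z + \<i> * cnj w) =
      hermite_biv m\<^sub>1 m\<^sub>2 m\<^sub>1' m\<^sub>2' z w * cnj (hermite_biv n\<^sub>1 n\<^sub>2 n\<^sub>1' n\<^sub>2' z w) *
       of_real (exp (- 2 * ((cmod z)\<^sup>2 + (cmod w)\<^sup>2)))" for z w
    unfolding gauss[symmetric] hermite_biv_def hermite_uni_eq complex_cnj_mult by (simp only: mult_ac)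
  have val: "hermite_inner m\<^sub>1 m\<^sub>2 n\<^sub>1 n\<^sub>2 * hermite_inner m\<^sub>1' m\<^sub>2' n\<^sub>1' n\<^sub>2' / 4 =
      of_real (pi\<^sup>2 / 4 * (fact m\<^sub>1 * fact m\<^sub>2 * fact m\<^sub>1' * fact m\<^sub>2') *
       of_bool ((m\<^sub>1, m\<^sub>2, m\<^sub>1', m\<^sub>2') = (n\<^sub>1, n\<^sub>2, n\<^sub>1', n\<^sub>2')))"
    by (simp add: hermite_inner_eq power2_eq_square)
  show ?thesis
    using lborel_pair_complex_change[OF F[of m\<^sub>1 m\<^sub>2 n\<^sub>1 n\<^sub>2] F[of m\<^sub>1' m\<^sub>2' n\<^sub>1' n\<^sub>2']]
    unfolding eq val .
qed

end
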